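(* Let $\lambda=\frac{q}{p}$ with $p,q$ positive integers, $0<q<p$ and $\gcd(p,q)=1$. Suppose that the scalar geometric mean inequality $x_1^{1-\lambda}x_2^{\lambda}\ge x_3$ admits a second-order cone representation drawn from a successive minimum $(p,q)$-mediated sequence: $x_ax_b\ge x_4^2$, $x_{i-1}x_{k_i}\ge x_i^2$ for $i=5,\ldots,l$, where $a,b\in\{1,2,3\}$, $k_i\in\{1,2,\ldots,i-2\}$, $l=\lceil\log_2(p)\rceil+3$, and $x_l=x_3$. Then the matrix geometric mean $G_\lambda$ admits the following semidefinite representation (for every matrix size $n$): $$\{(X_1,X_2,T)\in\mathbf{S}_{++}^n\times\mathbf{S}_+^n\times\mathbf{S}^n\mid G_\lambda(X_1,X_2)\succeq T\}$$ is equal to the set of all $(X_1,X_2,T)\in\mathbf{S}_{++}^n\times\mathbf{S}_+^n\times\mathbf{S}^n$ for which there exist $X_3,\ldots,X_l\in\mathbf{S}^n$ such that $X_3=X_l\succeq T$, $$\begin{bmatrix} X_a & X_4 \\ X_4 & X_b \end{bmatrix}\succeq0,\quad\text{and}\quad\begin{bmatrix} X_{i-1} & X_i \\ X_i & X_{k_i} \end{bmatrix}\succeq0\ \text{ for } i=5,\ldots,l.$$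
   Context: $\mathbf{S}^n,\mathbf{S}_+^n,\mathbf{S}_{++}^n$ are the sets of real symmetric, positive semidefinite, positive definite $n\times n$ matrices; $A\succeq B$ means $A-B$ is positive semidefinite. For $A\in\mathbf{S}_{++}^n$, $B\in\mathbf{S}_+^n$, $\lambda\in[0,1]$, the $\lambda$-weighted geometric mean is $G_\lambda(A,B)=A\#_\lambda B=A^{1/2}\left(A^{-1/2}BA^{-1/2}\right)^{\lambda}A^{1/2}$. Given an integer $p>0$, a set of nonnegative integers $A$ is a $p$-mediated sequence if every number in $A$ is the average of two distinct numbers in $A\cup\{0,p\}$; a $(p,q)$-mediated sequence is a $p$-mediated sequence containing $q$; it is minimum if it has the smallest cardinality among $(p,q)$-mediated sequences (which is $\lceil\log_2(p)\rceil$ when $\gcd(p,q)=1$). A minimum $(p,q)$-mediated sequence $\{q_1,\ldots,q_{l'}\}$ with $l'=\lceil\log_2(p)\rceil$ is successive if it can be sorted so that $q_i=\frac{q_{i-1}+t_i}{2}$ for $i=1,\ldots,l'$ and $q_{l'}=q$, where $t_i\in\{0,p,q,q_1,\ldots,q_{i-2}\}$ and $q_0\in\{p,q\}$. The second-order cone representation drawn from such a sequence is obtained by replacing each averaging relation $2u=v+w$ by the inequality $x_vx_w\ge x_u^2$, where the numbers $0,p,q$ correspond to the variables $x_1,x_2,x_3$ respectively and $q_i$ corresponds to $x_{i+3}$ for $i=1,\ldots,l'$. Thus $x_a,x_b$ correspond to $q_0,t_1$ (so $2q_1=q_0+t_1$ gives $x_ax_b\ge x_4^2$), $x_{k_i}$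 corresponds to $t_{i-3}$ (so $2q_{i-3}=q_{i-4}+t_{i-3}$ gives $x_{i-1}x_{k_i}\ge x_i^2$) for $i=5,\ldots,l$, and $q_{l'}=q$ gives the identification $x_l=x_3$. *)

theory Defs
  imports "HOL-Analysis.Analysis"
begin

definition sym_mats :: "(real ^ 'n ^ 'n) set" where
  "sym_mats = {A. transpose A = A}"

definition psd_mats :: "(real ^ 'n ^ 'n) set" where
  "psd_mats = {A \<in> sym_mats. \<forall>v. 0 \<le> v \<bullet> (A *v v)}"

definition pd_mats :: "(real ^ 'n ^ 'n) set" where
  "pd_mats = {A \<in> sym_mats. \<forall>v. v \<noteq> 0 \<longrightarrow> 0 < v \<bullet> (A *v v)}"

definition loewner_ge :: "real ^ 'n ^ 'n \<Rightarrow> real ^ 'n ^ 'n \<Rightarrow> bool"  (infix "\<succeq>" 50) where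
  "A \<succeq> B \<longleftrightarrow> A - B \<in> psd_mats"

text \<open>The matrix with block rows \<open>[A B]\<close> and \<open>[C D]\<close>; the summands of the index type
  \<open>'n + 'n\<close> index the two block rows, respectively columns.\<close>

definition block_mat ::
  "real ^ 'n ^ 'n \<Rightarrow> real ^ 'n ^ 'n \<Rightarrow> real ^ 'n ^ 'n \<Rightarrow> real ^ 'n ^ 'n
    \<Rightarrow> real ^ ('n + 'n) ^ ('n + 'n)" where
  "block_mat A B C D =
    (\<chi> i j. case i of
        Inl i' \<Rightarrow> (case j of Inl j' \<Rightarrow> A $ i' $ j' | Inr j' \<Rightarrow> B $ i' $ j')
      | Inr i' \<Rightarrow> (case j of Inl j' \<Rightarrow> C $ i' $ j' | Inr j' \<Rightarrow> D $ i' $ j'))"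

definition diag_mat :: "real ^ 'n \<Rightarrow> real ^ 'n ^ 'n" where
  "diag_mat d = (\<chi> i j. if i = j then d $ i else 0)"

text \<open>Real powers of a positive semidefinite matrix by spectral calculus. The result does not
  depend on the chosen spectral decomposition, so the description is unique. Exponent \<open>0\<close> is
  treated separately because \<open>0 powr 0 = 0\<close>, whereas the zeroth power of a singular matrix
  is to be the identity. For a negative exponent only positive definite matrices are meaningful.\<close>

definition mat_powr :: "real ^ 'n ^ 'n \<Rightarrow> real \<Rightarrow> real ^ 'n ^ 'n" where
  "mat_powr M r = (THE N. \<exists>U d. orthogonal_matrix U
      \<and> M = U ** diag_mat d ** transpose U
      \<and> N = U ** diag_mat (\<chi> i. if r = 0 then 1 else d $ i powr r) ** transpose U)"

definition geo_mean :: "real \<Rightarrow> real ^ 'n ^ 'n \<Rightarrow> real ^ 'n ^ 'n \<Rightarrow> real ^ 'n ^ 'n" where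
  "geo_mean r A B =
    mat_powr A (1/2) ** mat_powr (mat_powr A (-1/2) ** B ** mat_powr A (-1/2)) r
      ** mat_powr A (1/2)"

definition mediated :: "nat \<Rightarrow> nat set \<Rightarrow> bool" where
  "mediated p A \<longleftrightarrow>
    (\<forall>u\<in>A. \<exists>v\<in>A \<union> {0, p}. \<exists>w\<in>A \<union> {0, p}. v \<noteq> w \<and> 2 * u = v + w)"

definition pq_mediated :: "nat \<Rightarrow> nat \<Rightarrow> nat set \<Rightarrow> bool" where
  "pq_mediated p q A \<longleftrightarrow> mediated p A \<and> q \<in> A"

text \<open>Finiteness is explicit because infinite mediated sets exist and \<open>card\<close> is \<open>0\<close> on them.\<close>

definition minimum_pq_mediated :: "nat \<Rightarrow> nat \<Rightarrow> nat set \<Rightarrow> bool" where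
  "minimum_pq_mediated p q A \<longleftrightarrow> finite A \<and> pq_mediated p q A
    \<and> (\<forall>B. finite B \<and> pq_mediated p q B \<longrightarrow> card A \<le> card B)"

text \<open>The minimum sequence \<open>A\<close> is successive, as witnessed by the sorting \<open>s 1, \<dots>, s l'\<close> of \<open>A\<close>,
  the start value \<open>s 0\<close> and the second summands \<open>t 1, \<dots>, t l'\<close>. Truncated subtraction is harmless:
  for \<open>i \<le> 2\<close> the set \<open>{1..i - 2}\<close> is empty.\<close>

definition successive_via ::
  "nat \<Rightarrow> nat \<Rightarrow> nat set \<Rightarrow> (nat \<Rightarrow> nat) \<Rightarrow> (nat \<Rightarrow> nat) \<Rightarrow> bool" where
  "successive_via p q A s t \<longleftrightarrow>
    (let l' = nat \<lceil>log 2 (real p)\<rceil> in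
      minimum_pq_mediated p q A \<and> card A = l' \<and> bij_betw s {1..l'} A
      \<and> s 0 \<in> {p, q} \<and> s l' = q
      \<and> (\<forall>i\<in>{1..l'}. t i \<in> {0, p, q} \<union> s ` {1..i - 2} \<and> 2 * s i = s (i - 1) + t i))"

text \<open>The number to which the variable with index \<open>j\<close> corresponds.\<close>

definition node_val :: "nat \<Rightarrow> nat \<Rightarrow> (nat \<Rightarrow> nat) \<Rightarrow> nat \<Rightarrow> nat" where
  "node_val p q s j = (if j = 1 then 0 else if j = 2 then p else if j = 3 then q else s (j - 3))"

text \<open>The indices \<open>a\<close>, \<open>b\<close>, \<open>k i\<close> of the inequalities
  \<open>x a * x b \<ge> (x 4)\<^sup>2\<close> and \<open>x (i - 1) * x (k i) \<ge> (x i)\<^sup>2\<close>, \<open>i = 5, \<dots>, l\<close>,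
  come from the averaging relations of a successive minimum sequence.\<close>

definition drawn_from_successive ::
  "nat \<Rightarrow> nat \<Rightarrow> nat \<Rightarrow> nat \<Rightarrow> nat \<Rightarrow> (nat \<Rightarrow> nat) \<Rightarrow> bool" where
  "drawn_from_successive p q l a b k \<longleftrightarrow>
    (\<exists>A s t. successive_via p q A s t
      \<and> a \<in> {1, 2, 3} \<and> node_val p q s a = s 0
      \<and> b \<in> {1, 2, 3} \<and> node_val p q s b = t 1
      \<and> (\<forall>i\<in>{5..l}. k i \<in> {1..i - 2} \<and> node_val p q s (k i) = t (i - 3)))"

text \<open>The inequalities form a second-order cone representation of \<open>x1^(1-r) * x2^r \<ge> x3\<close> on the
  nonnegative orthant; as in the rotated cone \<open>u * v \<ge> w\<^sup>2\<close>, \<open>u, v \<ge> 0\<close>, the auxiliary variables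
  are nonnegative as well.\<close>

definition scalar_soc_rep ::
  "real \<Rightarrow> nat \<Rightarrow> nat \<Rightarrow> nat \<Rightarrow> (nat \<Rightarrow> nat) \<Rightarrow> bool" where
  "scalar_soc_rep r l a b k \<longleftrightarrow>
    {(x1, x2, x3). 0 \<le> x1 \<and> 0 \<le> x2 \<and> 0 \<le> x3 \<and> x1 powr (1 - r) * x2 powr r \<ge> x3} =
    {(x1, x2, x3). \<exists>x :: nat \<Rightarrow> real. x 1 = x1 \<and> x 2 = x2 \<and> x 3 = x3
       \<and> (\<forall>i\<in>{1..l}. 0 \<le> x i)
       \<and> x a * x b \<ge> (x 4)\<^sup>2
       \<and> (\<forall>i\<in>{5..l}. x (i - 1) * x (k i) \<ge> (x i)\<^sup>2)
       \<and> x l = x 3}"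

end

theory Submission
  imports Defs
begin

text \<open>The inclusion of the hypograph of the geometric mean in the set described by the linear matrix
  inequalities holds because the weighted geometric means with the exponents of the mediated sequence
  form a feasible chain (\<open>geo_mean_chain_feasible\<close>): \<open>X1\<close> and \<open>X2\<close> are diagonalised by one congruence
  (\<open>geo_mean_simultaneous_diagonalization\<close>), which turns the block inequalities into scalar ones.

  For the reverse inclusion, the off-diagonal block of a positive semidefinite block matrix lies below the
  geometric mean of its diagonal blocks (\<open>geometric_mean_maximal\<close>), and enlarging the diagonal blocks keeps
  the block matrix positive semidefinite. So upper bounds by powers of a single diagonal matrix \<open>d\<close> travel
  along the chain, with exponents averaged exactly as in the mediated sequence. The obstacle is the loop:
  \<open>X 3 = X l\<close> may occur as a diagonal block, so a bound on it is needed at the start. One starts from a bound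
  with a possibly large factor \<open>c\<close>. A passage through the chain replaces \<open>c\<close> by \<open>c powr \<theta>\<close>, where \<open>\<theta>\<close>, the loop
  weight, is the share of node 3 in the iterated average that defines node \<open>l\<close>
  (\<open>averaging_chain_maximal_pd\<close>). The scalar representation forces \<open>\<theta> < 1\<close>: otherwise the chain would not bound
  \<open>x 3\<close> by \<open>x 1\<close> and \<open>x 2\<close> (\<open>loop_weight_less_one\<close>). Iterating, the factor tends to 1, which leaves the geometric
  mean as the bound. This needs \<open>d\<close> positive; a singular \<open>X2\<close> is reached as a limit
  (\<open>averaging_chain_maximal\<close>).\<close>

section \<open>Quadratic forms of symmetric matrices\<close>

text \<open>The default rewriting of a transposed product to \<open>v*\<close> would hide the pattern
  \<open>W ** A ** transpose W\<close> on which every congruence argument below relies.\<close>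

declare transpose_matrix_vector [simp del]

lemma inner_mult_transpose:
  fixes A :: "real ^ 'n ^ 'm"
  shows "u \<bullet> (A *v v) = (transpose A *v u) \<bullet> v"
  by (simp add: transpose_matrix_vector dot_lmul_matrix)

lemma sym_mats_inner:
  assumes "A \<in> sym_mats"
  shows "u \<bullet> (A *v v) = (A *v u) \<bullet> v"
  using assms inner_mult_transpose[of u A v] by (simp add: sym_mats_def)

lemma inner_congruence:
  fixes W A :: "real ^ 'n ^ 'n"
  shows "u \<bullet> ((W ** A ** transpose W) *v v) = (transpose W *v u) \<bullet> (A *v (transpose W *v v))"
  by (simp add: matrix_vector_mul_assoc [symmetric] inner_mult_transpose [of u W])

lemma congruence_sym_mats:
  assumes "A \<in> sym_mats"
  shows "W ** A ** transpose W \<in> sym_mats"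
  using assms by (simp add: sym_mats_def matrix_transpose_mul matrix_mul_assoc)

lemma sym_mats_diff: "A \<in> sym_mats \<Longrightarrow> B \<in> sym_mats \<Longrightarrow> A - B \<in> sym_mats"
  by (simp add: sym_mats_def transpose_def vec_eq_iff)

lemma sym_mats_scaleR: "A \<in> sym_mats \<Longrightarrow> c *\<^sub>R A \<in> sym_mats"
  by (simp add: sym_mats_def transpose_scalar)

lemma loewner_ge_iff:
  assumes "A \<in> sym_mats" "B \<in> sym_mats"
  shows "A \<succeq> B \<longleftrightarrow> (\<forall>v. v \<bullet> (B *v v) \<le> v \<bullet> (A *v v))"
  using sym_mats_diff[OF assms]
  by (simp add: loewner_ge_def psd_mats_def matrix_vector_mult_diff_rdistrib inner_diff_right)

text \<open>For small \<open>t\<close> the linear term decides the sign, and it changes sign with \<open>t\<close>.\<close>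

lemma linear_coeff_zero_if_quadratic_nonneg:
  fixes b c :: real
  assumes "\<And>t. 0 \<le> t * b + t\<^sup>2 * c"
  shows "b = 0"
proof (rule ccontr)
  assume "b \<noteq> 0"
  \<comment> \<open>The minimiser for positive \<open>c\<close> is \<open>- b / (2 * c)\<close>; this one also serves \<open>c \<le> 0\<close>.\<close>
  define s where "s = - b / (1 + \<bar>c\<bar>)"
  have "s * b + s\<^sup>2 * c = b\<^sup>2 * (c - (1 + \<bar>c\<bar>)) / (1 + \<bar>c\<bar>)\<^sup>2"
    by (simp add: s_def divide_simps power2_eq_square) (simp add: algebra_simps)
  also have "\<dots> < 0"
    using \<open>b \<noteq> 0\<close> by (intro divide_neg_pos mult_pos_neg) auto
  finally show False
    using assms[of s] by simp
qed

text \<open>A vector \<open>v\<close> at which a nonnegative quadratic form vanishes is a minimiser, so the form has zero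
  derivative there, in particular in the direction \<open>N *v v\<close>. This is how an extremal value of a
  Rayleigh quotient becomes an eigenvalue. The version relative to an invariant subspace is needed
  for the spectral theorem; the one for the whole space reappears with a generalised eigenvalue in
  \<open>geometric_mean_maximal\<close>.\<close>

lemma isotropic_vector_in_kernel:
  fixes N :: "real ^ 'n ^ 'n"
  assumes "subspace S" "N \<in> sym_mats" "\<And>w. w \<in> S \<Longrightarrow> N *v w \<in> S"
    and nonneg: "\<And>w. w \<in> S \<Longrightarrow> 0 \<le> w \<bullet> (N *v w)"
    and v: "v \<in> S" "v \<bullet> (N *v v) = 0"
  shows "N *v v = 0"
proof -
  define w where "w = N *v v"
  have w: "w \<in> S"
    using assms by (simp add: w_def)
  have "0 \<le> t * (2 * (w \<bullet> w)) + t\<^sup>2 * (w \<bullet> (N *v w))" for t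
  proof -
    have "0 \<le> (v + t *\<^sub>R w) \<bullet> (N *v (v + t *\<^sub>R w))"
      using assms(1) v w by (intro nonneg subspace_add subspace_scale) auto
    also have "\<dots> = t * (2 * (w \<bullet> w)) + t\<^sup>2 * (w \<bullet> (N *v w))"
      using v(2) sym_mats_inner[OF assms(2), of v w] 
      by (simp add: matrix_vector_right_distrib matrix_vector_mult_scaleR inner_add_left
          inner_add_right w_def [symmetric] power2_eq_square distrib_left inner_commute)
    finally show ?thesis .
  qed
  then have "2 * (w \<bullet> w) = 0"
    by (rule linear_coeff_zero_if_quadratic_nonneg)
  then show ?thesis
    by (simp add: w_def)
qed

section \<open>The spectral theorem for real symmetric matrices\<close>

lemma continuous_on_quadratic_form:
  fixes A :: "real ^ 'n ^ 'n"
  shows "continuous_on X (\<lambda>v. v \<bullet> (A *v v))"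
  by (intro continuous_intros linear_continuous_on matrix_vector_mul_bounded_linear)

text \<open>A minimiser of the Rayleigh quotient on the unit sphere of the invariant subspace is an
  eigenvector, and the minimum is its eigenvalue.\<close>

lemma sym_mats_eigenvector_in_subspace:
  fixes A :: "real ^ 'n ^ 'n"
  assumes A: "A \<in> sym_mats" and S: "subspace S" "S \<noteq> {0}"
    and inv: "\<And>w. w \<in> S \<Longrightarrow> A *v w \<in> S"
  obtains v m where "v \<in> S" "norm v = 1" "A *v v = m *\<^sub>R v"
proof -
  obtain s where s: "s \<in> S" "s \<noteq> 0"
    using S subspace_0 by blast
  have "compact (sphere 0 1 \<inter> S)"
    by (simp add: closed_subspace compact_Int_closed S(1))
  moreover have "s /\<^sub>R norm s \<in> sphere 0 1 \<inter> S"
    using s S(1) by (simp add: subspace_scale)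
  ultimately obtain v where v: "v \<in> sphere 0 1 \<inter> S"
      and min: "\<And>w. w \<in> sphere 0 1 \<inter> S \<Longrightarrow> v \<bullet> (A *v v) \<le> w \<bullet> (A *v w)"
    using continuous_attains_inf[of "sphere 0 1 \<inter> S" "\<lambda>v. v \<bullet> (A *v v)"] continuous_on_quadratic_form
    by blast
  define m where "m = v \<bullet> (A *v v)"
  define N where "N = A - m *\<^sub>R mat 1"
  have N: "N *v w = A *v w - m *\<^sub>R w" for w
    by (simp add: N_def matrix_vector_mult_diff_rdistrib scaleR_matrix_vector_assoc [symmetric])
  have vv: "v \<bullet> v = 1"
    using v by (simp add: dot_square_norm)
  have "N *v v = 0"
  proof (rule isotropic_vector_in_kernel[OF S(1)])
    show "N \<in> sym_mats"
      unfolding N_def by (intro sym_mats_diff sym_mats_scaleR A) (simp add: sym_mats_def)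
    show "N *v w \<in> S" if "w \<in> S" for w
      unfolding N using that by (intro subspace_diff subspace_scale S(1) inv)
    show "v \<in> S" "v \<bullet> (N *v v) = 0"
      using v vv by (simp_all add: N inner_diff_right m_def)
    show "0 \<le> w \<bullet> (N *v w)" if w: "w \<in> S" for w
    proof (cases "w = 0")
      case False
      have "m \<le> (w /\<^sub>R norm w) \<bullet> (A *v (w /\<^sub>R norm w))"
        unfolding m_def using w False S(1) by (intro min) (simp add: subspace_scale)
      also have "\<dots> = (w \<bullet> (A *v w)) / (norm w)\<^sup>2"
        by (simp add: matrix_vector_mult_scaleR power2_eq_square divide_simps)
      finally show ?thesis
        using False by (simp add: N inner_diff_right dot_square_norm field_simps)
    qed simp
  qed
  then show thesis
    using that[of v m] v by (simp add: N)
qed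

text \<open>An orthonormal set of eigenvectors of maximal size spans the space: its orthogonal complement
  is invariant, and by maximality contains no further eigenvector.\<close>

theorem sym_mats_spectral:
  fixes A :: "real ^ 'n ^ 'n"
  assumes A: "A \<in> sym_mats"
  obtains U d where "orthogonal_matrix U" "A = U ** diag_mat d ** transpose U"
proof -
  define E where "E = {v. norm v = 1 \<and> (\<exists>m. A *v v = m *\<^sub>R v)}"
  define P where "P B \<longleftrightarrow> B \<subseteq> E \<and> pairwise orthogonal B" for B
  have indep: "finite B \<and> card B \<le> DIM(real ^ 'n) \<and> independent B" if "P B" for B
  proof -
    have "independent B"
      using that by (intro pairwise_orthogonal_independent) (auto simp: P_def E_def)
    then show ?thesis
      using independent_bound by blast
  qed
  have "P {}"
    by (simp add: P_def)
  moreover have "\<forall>B. P B \<longrightarrow> card B < Suc (DIM(real ^ 'n))"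
    using indep by (simp add: less_Suc_eq_le)
  ultimately obtain B where B: "P B" and max: "\<And>C. P C \<Longrightarrow> card C \<le> card B"
    by (metis ex_has_greatest_nat)
  define S where "S = {x. \<forall>v\<in>B. v \<bullet> x = 0}"
  have "S = {0}"
  proof (rule ccontr)
    assume "S \<noteq> {0}"
    have "A *v w \<in> S" if "w \<in> S" for w
    proof -
      have "v \<bullet> (A *v w) = 0" if v: "v \<in> B" for v
      proof -
        obtain m where "A *v v = m *\<^sub>R v"
          using v B by (auto simp: P_def E_def)
        then show ?thesis
          using v \<open>w \<in> S\<close> by (simp add: sym_mats_inner[OF A] S_def)
      qed
      then show ?thesis
        by (simp add: S_def)
    qed
    moreover have "subspace S"
      by (auto simp: subspace_def S_def inner_add_right)
    ultimately obtain v m where v: "v \<in> S" "norm v = 1" "A *v v = m *\<^sub>R v"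
      using sym_mats_eigenvector_in_subspace[OF A _ \<open>S \<noteq> {0}\<close>] by metis
    have "v \<notin> B"
      using v by (auto simp: S_def dot_square_norm)
    moreover have "P (insert v B)"
      using B v by (auto simp: P_def E_def pairwise_insert orthogonal_def S_def inner_commute)
    ultimately show False
      using max[of "insert v B"] indep[OF B] by simp
  qed
  have "span B = UNIV"
  proof (rule ccontr)
    assume "span B \<noteq> UNIV"
    then obtain a where "a \<noteq> 0" "\<forall>x\<in>span B. a \<bullet> x = 0"
      using span_not_UNIV_orthogonal by blast
    then have "a \<in> S"
      by (auto simp: S_def inner_commute span_base)
    then show False
      using \<open>S = {0}\<close> \<open>a \<noteq> 0\<close> by simp
  qed
  then have "card B = CARD('n)"
    using indep[OF B] dim_span_eq_card_independent[of B] by simp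
  then obtain h where h: "bij_betw h (UNIV :: 'n set) B"
    using indep[OF B] by (metis finite_same_card_bij finite_class.finite_UNIV)
  have hB: "h j \<in> B" for j
    using h by (auto simp: bij_betw_def)
  have "\<exists>m. A *v (h j) = m *\<^sub>R h j" for j
    using hB[of j] B by (auto simp: P_def E_def)
  then obtain f where f: "\<And>j. A *v (h j) = f j *\<^sub>R h j"
    by metis
  define U where "U = (\<chi> i j. h j $ i)"
  have col: "column j U = h j" for j
    by (simp add: column_def U_def vec_eq_iff)
  have U: "orthogonal_matrix U"
    unfolding orthogonal_matrix_orthonormal_columns col
  proof (intro conjI allI impI)
    show "norm (h j) = 1" for j
      using hB[of j] B by (auto simp: P_def E_def)
    show "orthogonal (h i) (h j)" if "i \<noteq> j" for i j
    proof -
      have "h i \<noteq> h j"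
        using h that by (simp add: bij_betw_def inj_eq)
      then show ?thesis
        using B hB by (simp add: P_def pairwise_def)
    qed
  qed
  have "A ** U = U ** diag_mat (\<chi> j. f j)"
  proof -
    have "(A ** U) $ i $ j = (A *v (h j)) $ i" for i j
      by (simp add: matrix_matrix_mult_def matrix_vector_mult_def U_def)
    then show ?thesis
      by (simp add: f vec_eq_iff matrix_matrix_mult_def diag_mat_def U_def if_distrib cong: if_cong)
  qed
  then have "A = U ** diag_mat (\<chi> j. f j) ** transpose U"
    using U by (metis matrix_mul_assoc matrix_mul_rid orthogonal_matrix_def)
  then show thesis
    using that U by blast
qed

section \<open>Spectral calculus and the geometric mean\<close>

lemma diag_mat_mult_vector: "(diag_mat d *v v) $ i = d $ i * v $ i"
  by (simp add: diag_mat_def matrix_vector_mult_def if_distrib[of "\<lambda>x. x * _"] cong: if_cong)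

lemma inner_diag_mat: "u \<bullet> (diag_mat d *v v) = (\<Sum>i\<in>UNIV. d $ i * (u $ i * v $ i))"
  by (simp add: inner_vec_def diag_mat_mult_vector mult_ac)

lemma diag_mat_sym_mats [simp]: "diag_mat d \<in> sym_mats"
  by (auto simp: sym_mats_def diag_mat_def transpose_def vec_eq_iff)

lemma diag_mat_one: "diag_mat (\<chi> i. 1) = mat 1"
  by (simp add: diag_mat_def mat_def vec_eq_iff)

lemma diag_mat_mult: "diag_mat d ** diag_mat e = diag_mat (\<chi> i. d $ i * e $ i)"
  by (simp add: diag_mat_def matrix_matrix_mult_def vec_eq_iff if_distrib[of "\<lambda>x. x * _"] cong: if_cong)

text \<open>The change of basis \<open>Z\<close> between two spectral decompositions links only coordinates with equal
  eigenvalues, and therefore intertwines the diagonal matrices of the values of \<open>f\<close> as well. Hence the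
  description that defines \<open>mat_powr\<close> has at most one solution.\<close>

lemma spectral_calculus_unique:
  fixes f :: "real \<Rightarrow> real"
  assumes U: "orthogonal_matrix U" and V: "orthogonal_matrix V"
    and eq: "U ** diag_mat d ** transpose U = V ** diag_mat e ** transpose V"
  shows "U ** diag_mat (\<chi> i. f (d $ i)) ** transpose U = V ** diag_mat (\<chi> i. f (e $ i)) ** transpose V"
proof -
  define Z where "Z = transpose V ** U"
  have UU: "transpose U ** U = mat 1" "U ** transpose U = mat 1"
    and VV: "transpose V ** V = mat 1" "V ** transpose V = mat 1"
    using U V by (auto simp: orthogonal_matrix_def)
  have VZ: "V ** Z = U"
    by (simp add: Z_def matrix_mul_assoc VV)
  have right: "(Z ** diag_mat a) $ i $ j = Z $ i $ j * a $ j"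
    and left: "(diag_mat a ** Z) $ i $ j = a $ i * Z $ i $ j" for a i j
    by (simp_all add: diag_mat_def matrix_matrix_mult_def if_distrib[of "\<lambda>x. x * _"] if_distrib[of "\<lambda>x. _ * x"] cong: if_cong)
  have "Z ** diag_mat d = transpose V ** (U ** diag_mat d ** transpose U) ** U"
    by (simp add: Z_def matrix_mul_assoc [symmetric] UU)
  also have "\<dots> = transpose V ** V ** diag_mat e ** transpose V ** U"
    by (simp add: eq matrix_mul_assoc)
  also have "\<dots> = diag_mat e ** Z"
    by (simp add: Z_def VV matrix_mul_assoc [symmetric])
  finally have entry: "Z $ i $ j * d $ j = e $ i * Z $ i $ j" for i j
    by (metis left right)
  have "Z $ i $ j * f (d $ j) = f (e $ i) * Z $ i $ j" for i j
    using entry[of i j] by (cases "Z $ i $ j = 0") auto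
  then have comm: "Z ** diag_mat (\<chi> i. f (d $ i)) = diag_mat (\<chi> i. f (e $ i)) ** Z"
    by (simp add: vec_eq_iff left right)
  have "U ** diag_mat (\<chi> i. f (d $ i)) ** transpose U = V ** (Z ** diag_mat (\<chi> i. f (d $ i))) ** transpose U"
    by (simp add: VZ matrix_mul_assoc)
  also have "\<dots> = V ** diag_mat (\<chi> i. f (e $ i)) ** transpose V ** (U ** transpose U)"
    unfolding comm by (simp add: Z_def matrix_mul_assoc)
  finally show ?thesis
    by (simp add: UU)
qed

lemma mat_powr_spectral:
  assumes "orthogonal_matrix U" "r \<noteq> 0"
  shows "mat_powr (U ** diag_mat d ** transpose U) r = U ** diag_mat (\<chi> i. d $ i powr r) ** transpose U"
  unfolding mat_powr_def
proof (rule the_equality)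
  show "\<exists>U' d'. orthogonal_matrix U' \<and> U ** diag_mat d ** transpose U = U' ** diag_mat d' ** transpose U' \<and>
    U ** diag_mat (\<chi> i. d $ i powr r) ** transpose U =
    U' ** diag_mat (\<chi> i. if r = 0 then 1 else d' $ i powr r) ** transpose U'"
    using assms by auto
next
  fix N
  assume "\<exists>U' d'. orthogonal_matrix U' \<and> U ** diag_mat d ** transpose U = U' ** diag_mat d' ** transpose U' \<and>
    N = U' ** diag_mat (\<chi> i. if r = 0 then 1 else d' $ i powr r) ** transpose U'"
  then obtain U' d' where *: "orthogonal_matrix U'"
    "U ** diag_mat d ** transpose U = U' ** diag_mat d' ** transpose U'"
    "N = U' ** diag_mat (\<chi> i. d' $ i powr r) ** transpose U'"
    using assms(2) by auto
  show "N = U ** diag_mat (\<chi> i. d $ i powr r) ** transpose U"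
    unfolding *(3) by (rule spectral_calculus_unique[OF *(1) assms(1) *(2)[symmetric], of "\<lambda>x. x powr r"])
qed

text \<open>The quadratic form takes the eigenvalues as its values at the columns of \<open>U\<close>, so definiteness of the
  matrix carries over to the signs of the eigenvalues.\<close>

lemma orthogonal_congruence_axis:
  fixes U :: "real ^ 'n ^ 'n"
  assumes "orthogonal_matrix U"
  shows "(U *v axis i 1) \<bullet> ((U ** diag_mat d ** transpose U) *v (U *v axis i 1)) = d $ i"
    and "U *v axis i 1 \<noteq> 0"
proof -
  have "transpose U *v (U *v axis i 1) = axis i 1"
    using assms by (simp add: orthogonal_matrix_def matrix_vector_mul_assoc)
  moreover from this show "U *v axis i 1 \<noteq> 0"
    by (metis axis_eq_0_iff matrix_vector_mult_0_right one_neq_zero)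
  ultimately show "(U *v axis i 1) \<bullet> ((U ** diag_mat d ** transpose U) *v (U *v axis i 1)) = d $ i"
    by (simp add: inner_congruence inner_axis' diag_mat_mult_vector)
qed

text \<open>A congruence, unlike a similarity, can diagonalise \<open>X1\<close> and \<open>X2\<close> at the same time, and it carries the
  whole family of weighted geometric means along: with \<open>H\<close> the square root of \<open>X1\<close>, \<open>K\<close> its inverse and
  \<open>K ** X2 ** K = V ** diag_mat d ** transpose V\<close>, the matrix \<open>W = H ** V\<close> does it. As linear matrix
  inequalities are invariant under congruence, this reduces the comparison of arbitrary chains with
  geometric means to \<open>X1 = mat 1\<close> and diagonal \<open>X2\<close>.\<close>

theorem geo_mean_simultaneous_diagonalization:
  fixes X1 X2 :: "real ^ 'n ^ 'n"
  assumes X1: "X1 \<in> pd_mats" and X2: "X2 \<in> psd_mats"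
  obtains W W' :: "real ^ 'n ^ 'n" and d where "W ** W' = mat 1" "W' ** W = mat 1" "\<And>i. 0 \<le> d $ i"
    "X1 = W ** transpose W" "X2 = W ** diag_mat d ** transpose W"
    "\<And>r. r \<noteq> 0 \<Longrightarrow> geo_mean r X1 X2 = W ** diag_mat (\<chi> i. d $ i powr r) ** transpose W"
proof -
  have "X1 \<in> sym_mats"
    using X1 by (simp add: pd_mats_def)
  then obtain U a where U: "orthogonal_matrix U" and X1_eq: "X1 = U ** diag_mat a ** transpose U"
    using sym_mats_spectral by blast
  have a: "0 < a $ i" for i
    using X1 orthogonal_congruence_axis(1)[where i = i and d = a, OF U] orthogonal_congruence_axis(2)[where i = i, OF U]
    unfolding X1_eq pd_mats_def
    by (metis (mono_tags, lifting) mem_Collect_eq)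
  define H where "H = mat_powr X1 (1/2)"
  define K where "K = mat_powr X1 (-1/2)"
  have H: "H = U ** diag_mat (\<chi> i. a $ i powr (1/2)) ** transpose U"
    and K: "K = U ** diag_mat (\<chi> i. a $ i powr (-1/2)) ** transpose U"
    unfolding H_def K_def X1_eq by (simp_all add: mat_powr_spectral[OF U])
  have UU: "transpose U ** U = mat 1" "U ** transpose U = mat 1"
    using U by (auto simp: orthogonal_matrix_def)
  have prod: "(U ** diag_mat x ** transpose U) ** (U ** diag_mat y ** transpose U)
      = U ** diag_mat (\<chi> i. x $ i * y $ i) ** transpose U" for x y
  proof -
    have "(U ** diag_mat x ** transpose U) ** (U ** diag_mat y ** transpose U)
      = U ** diag_mat x ** (transpose U ** U) ** diag_mat y ** transpose U"
      by (simp only: matrix_mul_assoc)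
    also have "\<dots> = U ** (diag_mat x ** diag_mat y) ** transpose U"
      by (simp add: UU matrix_mul_assoc)
    finally show ?thesis
      by (simp add: diag_mat_mult)
  qed
  have one: "U ** diag_mat (\<chi> i. 1) ** transpose U = mat 1"
    by (simp add: diag_mat_one UU)
  have nz: "a $ i \<noteq> 0" for i
    using a[of i] by simp
  have HK: "H ** K = mat 1" and KH: "K ** H = mat 1"
    unfolding H K prod by (simp_all add: powr_add [symmetric] nz one)
  have HH: "H ** H = X1"
    unfolding H X1_eq prod using a by (simp add: powr_add [symmetric] less_imp_le nz)
  have symH: "transpose H = H" and symK: "transpose K = K"
    unfolding H K using congruence_sym_mats[OF diag_mat_sym_mats] by (auto simp: sym_mats_def)
  define M where "M = K ** X2 ** K"
  have X2s: "X2 \<in> sym_mats"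
    using X2 by (simp add: psd_mats_def)
  have "M \<in> sym_mats"
    using congruence_sym_mats[OF X2s, of K] by (simp add: M_def symK)
  then obtain V d where V: "orthogonal_matrix V" and M_eq: "M = V ** diag_mat d ** transpose V"
    using sym_mats_spectral by blast
  have VV: "transpose V ** V = mat 1" "V ** transpose V = mat 1"
    using V by (auto simp: orthogonal_matrix_def)
  have d: "0 \<le> d $ i" for i
  proof -
    have "0 \<le> v \<bullet> (M *v v)" for v
      using X2 inner_congruence[of v K X2 v] by (simp add: M_def symK psd_mats_def)
    then show ?thesis
      using orthogonal_congruence_axis(1)[where i = i and d = d, OF V] unfolding M_eq by metis
  qed
  define W where "W = H ** V"
  define W' where "W' = transpose V ** K"
  have tW: "transpose W = transpose V ** H"
    by (simp add: W_def matrix_transpose_mul symH)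
  show thesis
  proof (rule that[of W W' d])
    have "W ** W' = H ** (V ** transpose V) ** K"
      by (simp add: W_def W'_def matrix_mul_assoc)
    then show "W ** W' = mat 1"
      by (simp add: VV HK)
    have "W' ** W = transpose V ** (K ** H) ** V"
      by (simp add: W_def W'_def matrix_mul_assoc)
    then show "W' ** W = mat 1"
      by (simp add: VV KH)
    show "0 \<le> d $ i" for i
      by (rule d)
    have "W ** transpose W = H ** (V ** transpose V) ** H"
      unfolding tW by (simp add: W_def matrix_mul_assoc)
    then show "X1 = W ** transpose W"
      by (simp add: VV HH)
    have "W ** diag_mat d ** transpose W = H ** M ** H"
      unfolding tW M_eq by (simp add: W_def matrix_mul_assoc)
    also have "\<dots> = (H ** K) ** X2 ** (K ** H)"
      by (simp only: M_def matrix_mul_assoc)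
    finally show "X2 = W ** diag_mat d ** transpose W"
      by (simp add: HK KH)
    show "geo_mean r X1 X2 = W ** diag_mat (\<chi> i. d $ i powr r) ** transpose W" if "r \<noteq> 0" for r
    proof -
      have "geo_mean r X1 X2 = H ** mat_powr M r ** H"
        by (simp add: geo_mean_def H_def K_def M_def)
      also have "\<dots> = W ** diag_mat (\<chi> i. d $ i powr r) ** transpose W"
        unfolding tW M_eq mat_powr_spectral[OF V that] by (simp add: W_def matrix_mul_assoc)
      finally show ?thesis .
    qed
  qed
qed

section \<open>Block matrices and the maximality of the geometric mean\<close>

lemma sum_over_sum_type:
  fixes g :: "'n::finite + 'm::finite \<Rightarrow> real"
  shows "(\<Sum>i\<in>UNIV. g i) = (\<Sum>i\<in>UNIV. g (Inl i)) + (\<Sum>i\<in>UNIV. g (Inr i))"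
  using sum.Plus[of "UNIV :: 'n set" "UNIV :: 'm set" g] by simp

lemma inner_sum_vector:
  fixes x y :: "real ^ ('n::finite + 'm::finite)"
  shows "x \<bullet> y = (\<Sum>i\<in>UNIV. x $ Inl i * y $ Inl i) + (\<Sum>i\<in>UNIV. x $ Inr i * y $ Inr i)"
  by (simp add: inner_vec_def sum_over_sum_type)

lemma block_mat_mult_vector:
  fixes A B C D :: "real ^ 'n ^ 'n"
  defines "up w \<equiv> (\<chi> i. w $ Inl i)" and "low w \<equiv> (\<chi> i. w $ Inr i)"
  shows "(block_mat A B C D *v w) $ Inl i = (A *v up w + B *v low w) $ i"
    and "(block_mat A B C D *v w) $ Inr i = (C *v up w + D *v low w) $ i"
  by (simp_all add: block_mat_def matrix_vector_mult_def sum_over_sum_type up_def low_def)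

lemma block_mat_psd_iff:
  fixes A B C :: "real ^ 'n ^ 'n"
  assumes "A \<in> sym_mats" "B \<in> sym_mats" "C \<in> sym_mats"
  shows "block_mat A C C B \<succeq> 0 \<longleftrightarrow>
    (\<forall>u v. 0 \<le> u \<bullet> (A *v u) + 2 * (u \<bullet> (C *v v)) + v \<bullet> (B *v v))"
proof -
  let ?M = "block_mat A C C B"
  have "?M \<in> sym_mats"
    using assms by (auto simp: sym_mats_def transpose_def block_mat_def vec_eq_iff split: sum.splits)
  moreover have form: "w \<bullet> (?M *v w) = u \<bullet> (A *v u) + 2 * (u \<bullet> (C *v v)) + v \<bullet> (B *v v)"
    if "u = (\<chi> i. w $ Inl i)" "v = (\<chi> i. w $ Inr i)" for u v w
  proof -
    have "w \<bullet> (?M *v w) = u \<bullet> (A *v u + C *v v) + v \<bullet> (C *v u + B *v v)"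
      unfolding inner_sum_vector block_mat_mult_vector that by (simp add: inner_vec_def)
    then show ?thesis
      using sym_mats_inner[OF assms(3), of u v] by (simp add: inner_add_right inner_commute)
  qed
  moreover have "(\<forall>w. 0 \<le> w \<bullet> (?M *v w)) \<longleftrightarrow>
      (\<forall>u v. 0 \<le> u \<bullet> (A *v u) + 2 * (u \<bullet> (C *v v)) + v \<bullet> (B *v v))" (is "?l \<longleftrightarrow> ?r")
  proof
    assume ?l
    show ?r
    proof (intro allI)
      fix u v :: "real ^ 'n"
      define w where "w = (\<chi> i. case i of Inl j \<Rightarrow> u $ j | Inr j \<Rightarrow> v $ j)"
      show "0 \<le> u \<bullet> (A *v u) + 2 * (u \<bullet> (C *v v)) + v \<bullet> (B *v v)"
        using \<open>?l\<close>[rule_format, of w] form[of u w v] by (simp add: w_def)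
    qed
  next
    assume ?r
    then show ?l
      using form by simp
  qed
  ultimately show ?thesis
    by (simp add: loewner_ge_def psd_mats_def)
qed

text \<open>The two matrix equations say that \<open>S\<close> is the geometric mean of \<open>A\<close> and \<open>B\<close>, that is, \<open>B = S A' S\<close> with
  \<open>A'\<close> the inverse of \<open>A\<close>. Suppose the largest value \<open>\<mu>\<close> of \<open>v \<bullet> (C - S) v / v \<bullet> A v\<close> were positive. At a
  maximiser \<open>v\<close> one has the generalised eigenvalue equation \<open>C v = S v + \<mu> A v = A (R v + \<mu> v)\<close>, and the
  block form at \<open>(- (R v + \<mu> v), v)\<close> is \<open>- 2 \<mu> (v \<bullet> S v) - \<mu>\<^sup>2 (v \<bullet> A v) < 0\<close>.\<close>

theorem geometric_mean_maximal:
  fixes A B C S R :: "real ^ 'n ^ 'n"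
  assumes A: "A \<in> pd_mats" and B: "B \<in> sym_mats" and S: "S \<in> psd_mats" and C: "C \<in> sym_mats"
    and SAR: "S = A ** R" and BSR: "B = S ** R"
    and block: "block_mat A C C B \<succeq> 0"
  shows "S \<succeq> C"
proof (rule ccontr)
  have As: "A \<in> sym_mats" and Ss: "S \<in> sym_mats"
    using A S by (auto simp: pd_mats_def psd_mats_def)
  have S_nonneg: "0 \<le> v \<bullet> (S *v v)" for v
    using S by (simp add: psd_mats_def)
  have A_pos: "0 < v \<bullet> (A *v v)" if "v \<noteq> 0" for v
    using A that by (simp add: pd_mats_def)
  assume "\<not> S \<succeq> C"
  then obtain z where z: "0 < z \<bullet> ((C - S) *v z)"
    by (auto simp: loewner_ge_iff[OF Ss C] not_le matrix_vector_mult_diff_rdistrib inner_diff_right)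
  define \<rho> where "\<rho> v = (v \<bullet> ((C - S) *v v)) / (v \<bullet> (A *v v))" for v
  have rho_scale: "\<rho> (c *\<^sub>R v) = \<rho> v" if "c \<noteq> 0" for c v
    using that by (simp add: \<rho>_def matrix_vector_mult_scaleR)
  have "v \<bullet> (A *v v) \<noteq> 0" if "v \<in> sphere 0 1" for v
    using A_pos[of v] that by force
  then have "continuous_on (sphere 0 1) \<rho>"
    unfolding \<rho>_def by (intro continuous_on_divide continuous_on_quadratic_form ballI)
  moreover have "z \<noteq> 0"
    using z by auto
  ultimately obtain v where v: "norm v = 1" and max: "\<And>w. norm w = 1 \<Longrightarrow> \<rho> w \<le> \<rho> v"
    using continuous_attains_sup[of "sphere 0 1" \<rho>] by (auto simp: sphere_eq_empty)
  define \<mu> where "\<mu> = \<rho> v"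
  have bound: "\<rho> w \<le> \<mu>" if "w \<noteq> 0" for w
    using max[of "inverse (norm w) *\<^sub>R w"] that by (simp add: \<mu>_def rho_scale)
  have "v \<noteq> 0"
    using v by auto
  have "0 < \<rho> z"
    using z A_pos[OF \<open>z \<noteq> 0\<close>] by (simp add: \<rho>_def)
  then have "0 < \<mu>"
    using bound[OF \<open>z \<noteq> 0\<close>] by simp
  have "(\<mu> *\<^sub>R A - (C - S)) *v v = 0"
  proof (rule isotropic_vector_in_kernel[of UNIV])
    show "\<mu> *\<^sub>R A - (C - S) \<in> sym_mats"
      by (intro sym_mats_diff sym_mats_scaleR As C Ss)
    have form: "w \<bullet> ((\<mu> *\<^sub>R A - (C - S)) *v w) = \<mu> * (w \<bullet> (A *v w)) - w \<bullet> ((C - S) *v w)" for w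
      by (simp add: matrix_vector_mult_diff_rdistrib [of _ "C - S"] scaleR_matrix_vector_assoc [symmetric] inner_diff_right)
    show "0 \<le> w \<bullet> ((\<mu> *\<^sub>R A - (C - S)) *v w)" for w
      using bound[of w] A_pos[of w] unfolding form \<rho>_def by (cases "w = 0") (simp_all add: divide_simps)
    show "v \<bullet> ((\<mu> *\<^sub>R A - (C - S)) *v v) = 0"
      using A_pos[OF \<open>v \<noteq> 0\<close>] unfolding form by (simp add: \<mu>_def \<rho>_def)
  qed auto
  then have Cv: "C *v v = S *v v + \<mu> *\<^sub>R (A *v v)"
    by (simp add: matrix_vector_mult_diff_rdistrib scaleR_matrix_vector_assoc [symmetric] algebra_simps)
  have SR: "S *v x = A *v (R *v x)" and BR: "B *v x = S *v (R *v x)" for x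
    by (simp_all add: SAR BSR matrix_vector_mul_assoc)
  \<comment> \<open>For fixed second component \<open>v\<close>, the block form is minimal at first component \<open>- x\<close>.\<close>
  define x where "x = R *v v + \<mu> *\<^sub>R v"
  have Ax: "A *v x = C *v v"
    by (simp add: x_def Cv SR matrix_vector_right_distrib matrix_vector_mult_scaleR)
  have "0 \<le> (- x) \<bullet> (A *v (- x)) + 2 * ((- x) \<bullet> (C *v v)) + v \<bullet> (B *v v)"
    by (rule block [unfolded block_mat_psd_iff[OF As B C], rule_format])
  also have "\<dots> = v \<bullet> (B *v v) - x \<bullet> (A *v x)"
  proof -
    have "A *v (- x) = - (A *v x)"
      using matrix_vector_mult_scaleR[of A "- 1" x] by simp
    then show ?thesis
      by (simp add: Ax)
  qed
  also have "x \<bullet> (A *v x) = v \<bullet> (B *v v) + 2 * \<mu> * (v \<bullet> (S *v v)) + \<mu>\<^sup>2 * (v \<bullet> (A *v v))"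
  proof -
    have "(R *v v) \<bullet> (A *v v) = v \<bullet> (S *v v)"
      using sym_mats_inner[OF As, of "R *v v" v] by (simp add: SR inner_commute)
    moreover have "(R *v v) \<bullet> (S *v v) = v \<bullet> (B *v v)"
      using sym_mats_inner[OF Ss, of "R *v v" v] by (simp add: BR inner_commute)
    ultimately show ?thesis
      by (simp add: Ax Cv) (simp add: x_def inner_add_left inner_add_right power2_eq_square algebra_simps)
  qed
  finally have "2 * \<mu> * (v \<bullet> (S *v v)) + \<mu>\<^sup>2 * (v \<bullet> (A *v v)) \<le> 0"
    by simp
  moreover have "0 \<le> 2 * \<mu> * (v \<bullet> (S *v v))" "0 < \<mu>\<^sup>2 * (v \<bullet> (A *v v))"
    using \<open>0 < \<mu>\<close> S_nonneg[of v] A_pos[OF \<open>v \<noteq> 0\<close>] by simp_all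
  ultimately show False
    by linarith
qed

lemma diag_mat_psd: "(\<And>i. 0 \<le> d $ i) \<Longrightarrow> diag_mat d \<in> psd_mats"
  by (auto simp: psd_mats_def inner_diag_mat intro!: sum_nonneg)

lemma diag_mat_pd: 
  assumes "\<And>i. 0 < d $ i" shows "diag_mat d \<in> pd_mats"
proof -
  have "0 < (\<Sum>i\<in>UNIV. d $ i * (v $ i * v $ i))" if "v \<noteq> 0" for v
  proof -
    have "\<exists>j. v $ j \<noteq> 0"
      using that by (simp add: vec_eq_iff)
    then obtain j where "v $ j \<noteq> 0" ..
    then have "0 < d $ j * (v $ j * v $ j)"
      using assms[of j] by (auto simp: zero_less_mult_iff linorder_neq_iff)
    then show ?thesis
      using assms by (intro sum_pos2[of _ j]) (auto simp: less_imp_le)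
  qed
  then show ?thesis
    by (simp add: pd_mats_def inner_diag_mat)
qed

lemma block_mat_mono:
  fixes A B C A' B' :: "real ^ 'n ^ 'n"
  assumes "block_mat A C C B \<succeq> 0" "A' \<succeq> A" "B' \<succeq> B"
    and "A \<in> sym_mats" "B \<in> sym_mats" "C \<in> sym_mats" "A' \<in> sym_mats" "B' \<in> sym_mats"
  shows "block_mat A' C C B' \<succeq> 0"
proof -
  have "0 \<le> u \<bullet> (A' *v u) + 2 * (u \<bullet> (C *v v)) + v \<bullet> (B' *v v)" for u v
  proof -
    have "0 \<le> u \<bullet> (A *v u) + 2 * (u \<bullet> (C *v v)) + v \<bullet> (B *v v)"
      using assms block_mat_psd_iff by blast
    moreover have "u \<bullet> (A *v u) \<le> u \<bullet> (A' *v u)" "v \<bullet> (B *v v) \<le> v \<bullet> (B' *v v)"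
      using assms loewner_ge_iff by blast+
    ultimately show ?thesis
      by linarith
  qed
  then show ?thesis
    using assms by (simp add: block_mat_psd_iff)
qed

text \<open>The only form in which maximality enters the induction along a chain: the two diagonal blocks may
  be arbitrary, as long as they are bounded by commuting matrices.\<close>

lemma block_mat_diag_bound:
  fixes A B C :: "real ^ 'n ^ 'n"
  assumes "block_mat A C C B \<succeq> 0" "diag_mat e \<succeq> A" "diag_mat f \<succeq> B"
    and "A \<in> sym_mats" "B \<in> sym_mats" "C \<in> sym_mats"
    and e: "\<And>i. 0 < e $ i" and f: "\<And>i. 0 < f $ i"
  shows "diag_mat (\<chi> i. sqrt (e $ i * f $ i)) \<succeq> C"
proof (rule geometric_mean_maximal)
  show "block_mat (diag_mat e) C C (diag_mat f) \<succeq> 0"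
    using assms(1-6) by (rule block_mat_mono) simp_all
  have "(e $ i * sqrt (f $ i / e $ i))\<^sup>2 = e $ i * f $ i" for i
    using e[of i] f[of i] by (simp add: power_mult_distrib) (simp add: power2_eq_square)
  then have "sqrt (e $ i * f $ i) = e $ i * sqrt (f $ i / e $ i)" for i
    by (rule real_sqrt_unique) (simp add: e f less_imp_le)
  then show "diag_mat (\<chi> i. sqrt (e $ i * f $ i)) = diag_mat e ** diag_mat (\<chi> i. sqrt (f $ i / e $ i))"
    by (simp add: diag_mat_mult)
  have "sqrt (e $ i * f $ i) * sqrt (f $ i / e $ i) = f $ i" for i
  proof -
    have "sqrt (e $ i * f $ i) * sqrt (f $ i / e $ i) = sqrt (e $ i * f $ i * (f $ i / e $ i))"
      by (rule real_sqrt_mult [symmetric])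
    also have "e $ i * f $ i * (f $ i / e $ i) = (f $ i)\<^sup>2"
      using e[of i] by (simp add: power2_eq_square)
    finally show ?thesis
      using f[of i] by simp
  qed
  then show "diag_mat f = diag_mat (\<chi> i. sqrt (e $ i * f $ i)) ** diag_mat (\<chi> i. sqrt (f $ i / e $ i))"
    by (simp add: diag_mat_mult)
  show "diag_mat e \<in> pd_mats" "diag_mat (\<chi> i. sqrt (e $ i * f $ i)) \<in> psd_mats"
    using e f by (auto intro!: diag_mat_pd diag_mat_psd simp: less_imp_le)
qed (use assms in simp_all)

section \<open>Chains of averages with a loop\<close>

lemma loewner_ge_trans:
  assumes "A \<succeq> B" "B \<succeq> C" "A \<in> sym_mats" "B \<in> sym_mats" "C \<in> sym_mats"
  shows "A \<succeq> C"
  using assms by (simp add: loewner_ge_iff) (meson order_trans)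

lemma loewner_ge_congruence:
  fixes A B W :: "real ^ 'n ^ 'n"
  assumes "A \<succeq> B" "A \<in> sym_mats" "B \<in> sym_mats"
  shows "W ** A ** transpose W \<succeq> W ** B ** transpose W"
  using assms by (simp add: loewner_ge_iff congruence_sym_mats inner_congruence)

lemma block_mat_congruence:
  fixes A B C W :: "real ^ 'n ^ 'n"
  assumes "block_mat A C C B \<succeq> 0" "A \<in> sym_mats" "B \<in> sym_mats" "C \<in> sym_mats"
  shows "block_mat (W ** A ** transpose W) (W ** C ** transpose W)
           (W ** C ** transpose W) (W ** B ** transpose W) \<succeq> 0"
  using assms by (simp add: block_mat_psd_iff congruence_sym_mats inner_congruence)

lemma diag_mat_ge_iff:
  assumes "Y \<in> sym_mats"
  shows "diag_mat e \<succeq> Y \<longleftrightarrow> (\<forall>v. v \<bullet> (Y *v v) \<le> (\<Sum>i\<in>UNIV. e $ i * (v $ i)\<^sup>2))"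
  using assms by (simp add: loewner_ge_iff inner_diag_mat power2_eq_square)

text \<open>This supplies a first, crude bound on the matrix of the loop, which the chain then improves.\<close>

lemma diag_mat_dominates:
  fixes Y :: "real ^ 'n ^ 'n"
  assumes Y: "Y \<in> sym_mats" and e: "\<And>i. 0 < e $ i"
  obtains c where "0 < c" "diag_mat (\<chi> i. c * e $ i) \<succeq> Y"
proof -
  obtain K where K: "0 < K" "\<And>v. norm (Y *v v) \<le> norm v * K"
    using bounded_linear.pos_bounded[OF matrix_vector_mul_bounded_linear[of Y]] by blast
  define m where "m = Min (range (\<lambda>i. e $ i))"
  have "0 < m"
    using e by (simp add: m_def)
  have m: "m \<le> e $ i" for i
    by (simp add: m_def)
  have "v \<bullet> (Y *v v) \<le> (\<Sum>i\<in>UNIV. (K / m * e $ i) * (v $ i)\<^sup>2)" for v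
  proof -
    have "v \<bullet> (Y *v v) \<le> norm v * norm (Y *v v)"
      by (rule norm_cauchy_schwarz)
    also have "\<dots> \<le> norm v * (norm v * K)"
      using K by (intro mult_left_mono) auto
    also have "\<dots> = (\<Sum>i\<in>UNIV. K * (v $ i)\<^sup>2)"
      by (simp add: sum_distrib_left [symmetric] norm_vec_def L2_set_def sum_nonneg
          power2_eq_square [symmetric] mult.assoc [symmetric])
    also have "\<dots> \<le> (\<Sum>i\<in>UNIV. (K / m * e $ i) * (v $ i)\<^sup>2)"
      using K(1) \<open>0 < m\<close> m by (intro sum_mono mult_right_mono) (simp_all add: field_simps)
    finally show ?thesis .
  qed
  then have "diag_mat (\<chi> i. K / m * e $ i) \<succeq> Y"
    by (simp add: diag_mat_ge_iff[OF Y])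
  then show thesis
    using that[of "K / m"] K(1) \<open>0 < m\<close> by simp
qed

text \<open>The functions \<open>L\<close> and \<open>R\<close> carry the shape of the chain, \<open>x\<close> a system of exponents on it; several such systems
  will share one shape. Nodes 1, 2, 3 are sources; the loop arises because the last node \<open>l\<close> is later identified with
  node 3.\<close>

definition averaging :: "nat \<Rightarrow> (nat \<Rightarrow> nat) \<Rightarrow> (nat \<Rightarrow> nat) \<Rightarrow> (nat \<Rightarrow> real) \<Rightarrow> bool" where
  "averaging l L R x \<longleftrightarrow>
    (\<forall>i\<in>{4..l}. L i \<in> {1..<i} \<and> R i \<in> {1..<i} \<and> 2 * x i = x (L i) + x (R i))"

lemma averaging_induct [consumes 2, case_names base step]:
  assumes "averaging l L R x" "i \<in> {1..l}"
    and base: "\<And>j. j \<in> {1, 2, 3} \<Longrightarrow> P j"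
    and step: "\<And>j. j \<in> {4..l} \<Longrightarrow> L j \<in> {1..l} \<Longrightarrow> R j \<in> {1..l} \<Longrightarrow>
      2 * x j = x (L j) + x (R j) \<Longrightarrow> P (L j) \<Longrightarrow> P (R j) \<Longrightarrow> P j"
  shows "P i"
  using assms(2)
proof (induction i rule: less_induct)
  case (less i)
  show ?case
  proof (cases "i \<in> {1, 2, 3}")
    case False
    then have i: "i \<in> {4..l}"
      using less.prems by auto
    then have "L i \<in> {1..<i}" "R i \<in> {1..<i}" "2 * x i = x (L i) + x (R i)"
      using assms(1) by (auto simp: averaging_def)
    then show ?thesis
      using i less.IH[of "L i"] less.IH[of "R i"] by (intro step[OF i]) auto
  qed (rule base)
qed

text \<open>The fraction of a node that is traced back to the loop node 3 when averages are unfolded down to the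
  sources: the harmonic function on the chain with boundary values 0, 0, 1. The value 0 of the last
  branch serves only to make the recursion well-founded for arbitrary \<open>L\<close>, \<open>R\<close>.\<close>

fun loop_weight :: "(nat \<Rightarrow> nat) \<Rightarrow> (nat \<Rightarrow> nat) \<Rightarrow> nat \<Rightarrow> real" where
  "loop_weight L R i =
    (if i \<le> 2 then 0 else if i = 3 then 1
     else if L i < i \<and> R i < i then (loop_weight L R (L i) + loop_weight L R (R i)) / 2 else 0)"

declare loop_weight.simps [simp del]

lemma loop_weight_base [simp]:
  "loop_weight L R (Suc 0) = 0" "loop_weight L R 2 = 0" "loop_weight L R 3 = 1"
  by (simp_all add: loop_weight.simps)

lemma averaging_loop_weight:
  assumes "averaging l L R x"
  shows "averaging l L R (loop_weight L R)"
proof -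
  have "2 * loop_weight L R i = loop_weight L R (L i) + loop_weight L R (R i)"
    if "i \<in> {4..l}" for i
    using that assms by (subst loop_weight.simps) (auto simp: averaging_def)
  then show ?thesis
    using assms by (simp add: averaging_def)
qed

lemma loop_weight_bounds:
  assumes "averaging l L R (loop_weight L R)" "i \<in> {1..l}"
  shows "0 \<le> loop_weight L R i \<and> loop_weight L R i \<le> 1"
  using assms
proof (induction rule: averaging_induct)
  case (base j)
  then show ?case by auto
next
  case (step j)
  then show ?case by linarith
qed

text \<open>If the loop weight of the last node were 1, the chain would bound node 3 by nothing but
  itself. Then \<open>x i = 2 powr loop_weight L R i\<close> would be a feasible scalar point with
  \<open>x 1 = x 2 = 1\<close> and \<open>x 3 = 2\<close>, which contradicts the scalar geometric mean inequality.\<close>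

lemma loop_weight_less_one:
  fixes r :: real
  assumes rep: "\<And>x. \<forall>i\<in>{1..l}. 0 \<le> x i \<Longrightarrow> \<forall>i\<in>{4..l}. x (L i) * x (R i) \<ge> (x i)\<^sup>2 \<Longrightarrow>
      x l = x 3 \<Longrightarrow> x 3 \<le> x 1 powr (1 - r) * x 2 powr r"
    and avg: "averaging l L R (loop_weight L R)" and l: "4 \<le> l"
  shows "loop_weight L R l < 1"
proof (rule ccontr)
  define x where "x i = 2 powr loop_weight L R i" for i
  assume "\<not> loop_weight L R l < 1"
  then have "loop_weight L R l = 1"
    using loop_weight_bounds[OF avg, of l] l by auto
  moreover have "x (L i) * x (R i) = (x i)\<^sup>2" if "i \<in> {4..l}" for i
  proof -
    have "loop_weight L R (L i) + loop_weight L R (R i) = 2 * loop_weight L R i"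
      using avg that by (simp add: averaging_def)
    then show ?thesis
      by (simp add: x_def powr_add [symmetric] power2_eq_square)
  qed
  ultimately have "x 3 \<le> x 1 powr (1 - r) * x 2 powr r"
    by (intro rep) (auto simp: x_def)
  then show False
    by (simp add: x_def)
qed

text \<open>Taking geometric means of the commuting matrices \<open>c\<^sup>\<theta> d\<^sup>\<nu>\<close> averages their exponents \<open>\<theta>\<close> and \<open>\<nu>\<close>, so bounds
  of this form propagate along the chain from the sources.\<close>

lemma averaging_chain_bound:
  fixes Y :: "nat \<Rightarrow> real ^ 'n ^ 'n" and \<theta> \<nu> :: "nat \<Rightarrow> real"
  assumes sym: "\<And>i. i \<in> {1..l} \<Longrightarrow> Y i \<in> sym_mats"
    and block: "\<And>i. i \<in> {4..l} \<Longrightarrow> block_mat (Y (L i)) (Y i) (Y i) (Y (R i)) \<succeq> 0"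
    and \<theta>: "averaging l L R \<theta>" and \<nu>: "averaging l L R \<nu>"
    and c: "0 < c" and d: "\<And>i. 0 < d $ i"
    and base: "\<And>j. j \<in> {1, 2, 3} \<Longrightarrow> diag_mat (\<chi> i. c powr \<theta> j * d $ i powr \<nu> j) \<succeq> Y j"
    and j: "j \<in> {1..l}"
  shows "diag_mat (\<chi> i. c powr \<theta> j * d $ i powr \<nu> j) \<succeq> Y j"
  using \<theta> j
proof (induction rule: averaging_induct)
  case (base j)
  then show ?case by (rule assms)
next
  case (step j)
  have nz: "c \<noteq> 0" "d $ i \<noteq> 0" for i
    using c d[of i] by auto
  have "diag_mat (\<chi> i. sqrt ((c powr \<theta> (L j) * d $ i powr \<nu> (L j)) * (c powr \<theta> (R j) * d $ i powr \<nu> (R j)))) \<succeq> Y j"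
    using block_mat_diag_bound[OF block[OF step(1)] step(5,6)] step(1-3) sym c d nz by simp
  moreover have "sqrt ((c powr \<theta> (L j) * d $ i powr \<nu> (L j)) * (c powr \<theta> (R j) * d $ i powr \<nu> (R j)))
    = c powr \<theta> j * d $ i powr \<nu> j" for i
  proof -
    have "2 * \<nu> j = \<nu> (L j) + \<nu> (R j)"
      using \<nu> step(1) by (simp add: averaging_def)
    then have "(c powr \<theta> (L j) * d $ i powr \<nu> (L j)) * (c powr \<theta> (R j) * d $ i powr \<nu> (R j))
      = c powr (2 * \<theta> j) * d $ i powr (2 * \<nu> j)"
      unfolding step(4) by (simp add: powr_add mult_ac)
    also have "\<dots> = (c powr \<theta> j * d $ i powr \<nu> j)\<^sup>2"
      by (simp add: power_mult_distrib powr_add [symmetric] power2_eq_square mult_ac flip: mult_2)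
    finally show ?thesis
      by simp
  qed
  ultimately show ?case
    by simp
qed

lemma scaled_bounds_limit:
  fixes Y :: "real ^ 'n ^ 'n"
  assumes Y: "Y \<in> sym_mats" and lim: "\<And>i. (\<lambda>n. E n $ i) \<longlonglongrightarrow> e $ i"
    and bound: "\<And>n :: nat. diag_mat (E n) \<succeq> Y"
  shows "diag_mat e \<succeq> Y"
  unfolding diag_mat_ge_iff[OF Y]
proof
  fix v
  have "(\<lambda>n. \<Sum>i\<in>UNIV. E n $ i * (v $ i)\<^sup>2) \<longlonglongrightarrow> (\<Sum>i\<in>UNIV. e $ i * (v $ i)\<^sup>2)"
    by (intro tendsto_sum tendsto_mult lim tendsto_const)
  then show "v \<bullet> (Y *v v) \<le> (\<Sum>i\<in>UNIV. e $ i * (v $ i)\<^sup>2)"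
    by (rule LIMSEQ_le_const) (use bound in \<open>simp add: diag_mat_ge_iff[OF Y]\<close>)
qed

text \<open>Any factor \<open>c\<close> in a bound on the loop node can be improved: after one passage through the loop it becomes
  \<open>c powr \<theta> l\<close> with the loop weight \<open>\<theta>\<close>, because the nodes 1 and 2 are bounded with factor 1. As \<open>\<theta> l < 1\<close>, iterating drives the
  factor to 1.\<close>

lemma averaging_chain_maximal_pd:
  fixes Y :: "nat \<Rightarrow> real ^ 'n ^ 'n" and \<nu> :: "nat \<Rightarrow> real"
  assumes l: "4 \<le> l"
    and sym: "\<And>i. i \<in> {1..l} \<Longrightarrow> Y i \<in> sym_mats"
    and block: "\<And>i. i \<in> {4..l} \<Longrightarrow> block_mat (Y (L i)) (Y i) (Y i) (Y (R i)) \<succeq> 0"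
    and \<nu>: "averaging l L R \<nu>" "\<nu> 1 = 0" "\<nu> 2 = 1" "\<nu> l = \<nu> 3"
    and loop: "loop_weight L R l < 1" "Y l = Y 3"
    and d: "\<And>i. 0 < d $ i"
    and Y1: "mat 1 \<succeq> Y 1" and Y2: "diag_mat d \<succeq> Y 2"
  shows "diag_mat (\<chi> i. d $ i powr \<nu> 3) \<succeq> Y 3"
proof -
  define \<theta> where "\<theta> = loop_weight L R"
  have \<theta>: "averaging l L R \<theta>"
    unfolding \<theta>_def by (rule averaging_loop_weight[OF \<nu>(1)])
  have improve: "diag_mat (\<chi> i. c powr \<theta> l * d $ i powr \<nu> 3) \<succeq> Y 3"
    if c: "0 < c" and "diag_mat (\<chi> i. c * d $ i powr \<nu> 3) \<succeq> Y 3" for c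
  proof -
    have "diag_mat (\<chi> i. c powr \<theta> j * d $ i powr \<nu> j) \<succeq> Y j" if "j \<in> {1, 2, 3}" for j
      using that \<open>diag_mat _ \<succeq> Y 3\<close> Y1 Y2 c d[THEN less_imp_le] d[THEN less_imp_neq] \<nu>(2,3)
      by (auto simp: \<theta>_def diag_mat_one)
    from averaging_chain_bound[OF sym block \<theta> \<nu>(1) c d this, of l] show ?thesis
      using l loop(2) \<nu>(4) by simp
  qed
  have Y3: "Y 3 \<in> sym_mats"
    using sym l by simp
  obtain c where c: "0 < c" "diag_mat (\<chi> i. c * d $ i powr \<nu> 3) \<succeq> Y 3"
    using diag_mat_dominates[OF Y3, of "\<chi> i. d $ i powr \<nu> 3"] d by (auto simp: less_imp_neq [symmetric])
  have iterate: "diag_mat (\<chi> i. c powr (\<theta> l ^ n) * d $ i powr \<nu> 3) \<succeq> Y 3" for n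
  proof (induction n)
    case 0
    then show ?case
      using c by simp
  next
    case (Suc n)
    then show ?case
      using improve[of "c powr (\<theta> l ^ n)"] c(1) by (simp add: powr_powr mult.commute)
  qed
  have "0 \<le> \<theta> l" "\<theta> l < 1"
    using loop_weight_bounds[of l L R l] \<theta> loop(1) l by (auto simp: \<theta>_def)
  then have "(\<lambda>n. \<theta> l ^ n) \<longlonglongrightarrow> 0"
    by (intro LIMSEQ_power_zero) simp
  then have "(\<lambda>n. c powr (\<theta> l ^ n) * d $ i powr \<nu> 3) \<longlonglongrightarrow> c powr 0 * d $ i powr \<nu> 3" for i
    using c(1) by (intro tendsto_mult tendsto_powr tendsto_const) auto
  then show ?thesis
    using c(1) by (intro scaled_bounds_limit[OF Y3 _ iterate]) simp
qed

text \<open>A singular \<open>d\<close> is the limit of positive \<open>d + \<epsilon>\<close>; enlarging a diagonal block keeps all block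
  inequalities valid, so the positive case applies to each \<open>\<epsilon>\<close>.\<close>

lemma averaging_chain_maximal:
  fixes Y :: "nat \<Rightarrow> real ^ 'n ^ 'n" and \<nu> :: "nat \<Rightarrow> real"
  assumes l: "4 \<le> l"
    and sym: "\<And>i. i \<in> {1..l} \<Longrightarrow> Y i \<in> sym_mats"
    and block: "\<And>i. i \<in> {4..l} \<Longrightarrow> block_mat (Y (L i)) (Y i) (Y i) (Y (R i)) \<succeq> 0"
    and \<nu>: "averaging l L R \<nu>" "\<nu> 1 = 0" "\<nu> 2 = 1" "\<nu> l = \<nu> 3" "0 < \<nu> 3"
    and loop: "loop_weight L R l < 1" "Y l = Y 3"
    and d: "\<And>i. 0 \<le> d $ i"
    and Y1: "Y 1 = mat 1" and Y2: "Y 2 = diag_mat d"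
  shows "diag_mat (\<chi> i. d $ i powr \<nu> 3) \<succeq> Y 3"
proof -
  have Y3: "Y 3 \<in> sym_mats"
    using sym l by simp
  have "diag_mat (\<chi> i. (d $ i + inverse (real (Suc n))) powr \<nu> 3) \<succeq> Y 3" for n
  proof -
    define f where "f = (\<chi> i. d $ i + inverse (real (Suc n)))"
    have "diag_mat (\<chi> i. f $ i powr \<nu> 3) \<succeq> Y 3"
    proof (rule averaging_chain_maximal_pd[OF l sym block \<nu>(1-4) loop])
      show "0 < f $ i" for i
        using d[of i] by (simp add: f_def add_nonneg_pos)
      show "mat 1 \<succeq> Y 1"
        unfolding Y1 by (simp add: loewner_ge_iff sym_mats_def)
      show "diag_mat f \<succeq> Y 2"
        unfolding Y2 by (auto simp: loewner_ge_iff inner_diag_mat f_def intro!: sum_mono mult_right_mono)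
    qed
    then show ?thesis
      by (simp add: f_def)
  qed
  note bound = this
  have lim: "(\<lambda>n. (d $ i + inverse (real (Suc n))) powr \<nu> 3) \<longlonglongrightarrow> d $ i powr \<nu> 3" for i
  proof -
    have "(\<lambda>n. d $ i + inverse (real (Suc n))) \<longlonglongrightarrow> d $ i"
      by (rule LIMSEQ_inverse_real_of_nat_add)
    then show ?thesis
      using d[of i] \<nu>(5) by (intro tendsto_powr2 tendsto_const) auto
  qed
  show ?thesis
  proof (rule scaled_bounds_limit[OF Y3 _ bound])
    show "(\<lambda>n. (\<chi> i. (d $ i + inverse (real (Suc n))) powr \<nu> 3) $ i) \<longlonglongrightarrow> (\<chi> i. d $ i powr \<nu> 3) $ i" for i
      using lim[of i] by (simp only: vec_lambda_beta)
  qed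
qed

section \<open>The chain of geometric means\<close>

text \<open>The power with exponent 0 has to be 1 at base 0 too: node 1 of the chain is \<open>X1\<close> itself, even if
  \<open>X2\<close> is singular.\<close>

definition powr1 :: "real \<Rightarrow> real \<Rightarrow> real" where
  "powr1 x r = (if r = 0 then 1 else x powr r)"

lemma powr1_midpoint:
  assumes "0 \<le> x" "0 \<le> r" "0 \<le> s" "2 * m = r + s"
  shows "(powr1 x m)\<^sup>2 \<le> powr1 x r * powr1 x s"
proof (cases "x = 0")
  case True
  then show ?thesis
    using assms by (auto simp: powr1_def)
next
  case False
  then have "powr1 x t = x powr t" for t
    using assms(1) by (simp add: powr1_def)
  then show ?thesis
    by (simp add: power2_eq_square powr_add [symmetric] assms(4) [symmetric])
qed

lemma binary_form_nonneg:
  fixes e f g u v :: real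
  assumes "0 \<le> e" "0 \<le> f" "g\<^sup>2 \<le> e * f"
  shows "0 \<le> e * (u * u) + 2 * (g * (u * v)) + f * (v * v)"
proof (cases "e = 0")
  case True
  then show ?thesis
    using assms by simp
next
  case False
  have "0 \<le> (e * u + g * v)\<^sup>2 + (e * f - g\<^sup>2) * v\<^sup>2"
    using assms by simp
  also have "\<dots> = e * (e * (u * u) + 2 * (g * (u * v)) + f * (v * v))"
    by (simp add: power2_eq_square algebra_simps)
  finally show ?thesis
    using False assms(1) by (simp add: zero_le_mult_iff)
qed

lemma block_mat_diag_psd:
  assumes "\<And>i. 0 \<le> e $ i" "\<And>i. 0 \<le> f $ i" "\<And>i. (g $ i)\<^sup>2 \<le> e $ i * f $ i"
  shows "block_mat (diag_mat e) (diag_mat g) (diag_mat g) (diag_mat f) \<succeq> 0"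
proof -
  have "0 \<le> u \<bullet> (diag_mat e *v u) + 2 * (u \<bullet> (diag_mat g *v v)) + v \<bullet> (diag_mat f *v v)" for u v
  proof -
    have "0 \<le> (\<Sum>i\<in>UNIV. e $ i * (u $ i * u $ i) + 2 * (g $ i * (u $ i * v $ i)) + f $ i * (v $ i * v $ i))"
      using assms by (intro sum_nonneg binary_form_nonneg)
    then show ?thesis
      by (simp add: inner_diag_mat sum.distrib sum_distrib_left)
  qed
  then show ?thesis
    by (simp add: block_mat_psd_iff)
qed

lemma ball_from_4:
  fixes l :: nat
  assumes "4 \<le> l"
  shows "(\<forall>i\<in>{4..l}. P i) \<longleftrightarrow> P 4 \<and> (\<forall>i\<in>{5..l}. P i)"
proof -
  have "{4..l} = insert 4 {5..l}"
    using assms by auto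
  then show ?thesis
    by simp
qed

text \<open>The exponents of the chain are the numbers of the mediated sequence divided by \<open>p\<close>. Treating index 4
  like the later ones, with neighbours \<open>a\<close> and \<open>b\<close>, turns the two kinds of averaging relations into one.\<close>

lemma drawn_from_successive_averaging:
  assumes "0 < q" "q < p" "l = nat \<lceil>log 2 (real p)\<rceil> + 3"
    and "drawn_from_successive p q l a b k"
  obtains \<nu> where "averaging l ((\<lambda>i. i - 1)(4 := a)) (k(4 := b)) \<nu>"
    "\<nu> 1 = 0" "\<nu> 2 = 1" "\<nu> 3 = real q / real p" "\<nu> l = real q / real p" "\<And>i. 0 \<le> \<nu> i"
proof -
  from assms(4) obtain A s t where via: "successive_via p q A s t"
    and a: "a \<in> {1, 2, 3}" "node_val p q s a = s 0"
    and b: "b \<in> {1, 2, 3}" "node_val p q s b = t 1"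
    and k: "\<forall>i\<in>{5..l}. k i \<in> {1..i - 2} \<and> node_val p q s (k i) = t (i - 3)"
    unfolding drawn_from_successive_def by blast
  have "l - 3 = nat \<lceil>log 2 (real p)\<rceil>"
    using assms(3) by simp
  with via have avg: "\<And>i. i \<in> {1..l - 3} \<Longrightarrow> 2 * s i = s (i - 1) + t i" and last: "s (l - 3) = q"
    by (simp_all add: successive_via_def Let_def)
  have "0 < log 2 (real p)"
    using assms by simp
  then have l: "4 \<le> l"
    using assms(3) by linarith
  define \<nu> where "\<nu> i = real (node_val p q s i) / real p" for i
  have node: "node_val p q s i = s (i - 3)" if "i \<ge> 4" for i
    using that by (simp add: node_val_def)
  have double: "2 * \<nu> i = \<nu> j + \<nu> m"
    if "2 * node_val p q s i = node_val p q s j + node_val p q s m" for i j m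
  proof -
    have "2 * real (node_val p q s i) = real (node_val p q s j) + real (node_val p q s m)"
      using that by linarith
    then show ?thesis
      by (simp add: \<nu>_def add_divide_distrib [symmetric])
  qed
  show thesis
  proof (rule that[of \<nu>])
    show "averaging l ((\<lambda>i. i - 1)(4 := a)) (k(4 := b)) \<nu>"
      unfolding averaging_def ball_from_4[OF l]
    proof (intro conjI ballI)
      show "2 * \<nu> 4 = \<nu> (((\<lambda>i. i - 1)(4 := a)) 4) + \<nu> ((k(4 := b)) 4)"
        using avg[of 1] l a(2) b(2) by (simp add: double node)
      fix i assume i: "i \<in> {5..l}"
      have "2 * s (i - 3) = s (i - 1 - 3) + t (i - 3)"
      proof -
        have "1 \<le> i - 3" "i - 3 \<le> l - 3" "i - 3 - 1 = i - 1 - 3"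
          using i by auto
        then show ?thesis
          using avg[of "i - 3"] by (simp only: atLeastAtMost_iff)
      qed
      then have "2 * node_val p q s i = node_val p q s (i - 1) + node_val p q s (k i)"
        using i k by (auto simp: node)
      then show "2 * \<nu> i = \<nu> (((\<lambda>i. i - 1)(4 := a)) i) + \<nu> ((k(4 := b)) i)"
        using i double by auto
      have "k i \<in> {1..i - 2}"
        using k i by blast
      then show "((\<lambda>i. i - 1)(4 := a)) i \<in> {1..<i}" "(k(4 := b)) i \<in> {1..<i}"
        using i by auto
    qed (use a(1) b(1) in auto)
    show "\<nu> l = real q / real p"
      using l last by (simp add: \<nu>_def node)
  qed (use assms(2) in \<open>simp_all add: \<nu>_def node_val_def\<close>)
qed

lemma scalar_soc_rep_loop_weight:
  assumes "scalar_soc_rep lam l a b k" "4 \<le> l"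
    and "averaging l ((\<lambda>i. i - 1)(4 := a)) (k(4 := b)) \<nu>"
  shows "loop_weight ((\<lambda>i. i - 1)(4 := a)) (k(4 := b)) l < 1"
proof (rule loop_weight_less_one[OF _ averaging_loop_weight[OF assms(3)] assms(2)])
  fix x :: "nat \<Rightarrow> real"
  assume x: "\<forall>i\<in>{1..l}. 0 \<le> x i" "x l = x 3"
    "\<forall>i\<in>{4..l}. (x i)\<^sup>2 \<le> x (((\<lambda>i. i - 1)(4 := a)) i) * x ((k(4 := b)) i)"
  then have "(x 4)\<^sup>2 \<le> x a * x b" "\<forall>i\<in>{5..l}. (x i)\<^sup>2 \<le> x (i - 1) * x (k i)"
    unfolding ball_from_4[OF assms(2)] by auto
  then have "(x 1, x 2, x 3) \<in> {(x1, x2, x3). \<exists>x :: nat \<Rightarrow> real. x 1 = x1 \<and> x 2 = x2 \<and> x 3 = x3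
       \<and> (\<forall>i\<in>{1..l}. 0 \<le> x i)
       \<and> x a * x b \<ge> (x 4)\<^sup>2
       \<and> (\<forall>i\<in>{5..l}. x (i - 1) * x (k i) \<ge> (x i)\<^sup>2)
       \<and> x l = x 3}"
    using x(1,2) by blast
  then show "x 3 \<le> x 1 powr (1 - lam) * x 2 powr lam"
    unfolding assms(1)[unfolded scalar_soc_rep_def, symmetric] by simp
qed

text \<open>The weighted geometric means with exponents \<open>\<nu> i\<close> themselves form a feasible chain: simultaneously
  diagonalised, each block inequality splits into scalar inequalities
  \<open>(d powr m)\<^sup>2 \<le> d powr r * d powr s\<close> for a midpoint \<open>m\<close> of \<open>r\<close> and \<open>s\<close>.\<close>

lemma geo_mean_chain_feasible:
  fixes X1 X2 :: "real ^ 'n ^ 'n"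
  assumes X1: "X1 \<in> pd_mats" and X2: "X2 \<in> psd_mats"
    and \<nu>: "averaging l L R \<nu>" "\<nu> 1 = 0" "\<nu> 2 = 1" "\<nu> 3 = r" "\<And>i. 0 \<le> \<nu> i"
    and r: "0 < r"
  obtains X :: "nat \<Rightarrow> real ^ 'n ^ 'n" where "X 1 = X1" "X 2 = X2" "\<And>i. X i \<in> sym_mats"
    "\<And>i. \<nu> i = r \<Longrightarrow> X i = geo_mean r X1 X2"
    "\<And>i. i \<in> {4..l} \<Longrightarrow> block_mat (X (L i)) (X i) (X i) (X (R i)) \<succeq> 0"
proof -
  obtain W W' :: "real ^ 'n ^ 'n" and d where d: "\<And>i. 0 \<le> d $ i"
    and X1_eq: "X1 = W ** transpose W" and X2_eq: "X2 = W ** diag_mat d ** transpose W"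
    and geo: "\<And>r. r \<noteq> 0 \<Longrightarrow> geo_mean r X1 X2 = W ** diag_mat (\<chi> i. d $ i powr r) ** transpose W"
    using geo_mean_simultaneous_diagonalization[OF X1 X2] by metis
  define D where "D j = diag_mat (\<chi> i. powr1 (d $ i) (\<nu> j))" for j
  define X where "X j = W ** D j ** transpose W" for j
  show thesis
  proof (rule that[of X])
    show "X 1 = X1"
      by (simp add: X_def D_def \<nu>(2) X1_eq powr1_def diag_mat_one del: One_nat_def)
    show "X 2 = X2"
      using d by (simp add: X_def D_def \<nu>(3) X2_eq powr1_def)
    show "X i \<in> sym_mats" for i
      unfolding X_def D_def by (intro congruence_sym_mats diag_mat_sym_mats)
    show "X i = geo_mean r X1 X2" if "\<nu> i = r" for i
      using r that by (simp add: X_def D_def geo powr1_def)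
    show "block_mat (X (L i)) (X i) (X i) (X (R i)) \<succeq> 0" if "i \<in> {4..l}" for i
      unfolding X_def
    proof (rule block_mat_congruence)
      have "2 * \<nu> i = \<nu> (L i) + \<nu> (R i)"
        using \<nu>(1) that by (simp add: averaging_def)
      then show "block_mat (D (L i)) (D i) (D i) (D (R i)) \<succeq> 0"
        unfolding D_def using d \<nu>(5)
        by (intro block_mat_diag_psd) (simp_all add: powr1_midpoint, simp_all add: powr1_def)
    qed (simp_all add: D_def)
  qed
qed

text \<open>Every feasible chain ends below the geometric mean: \<open>averaging_chain_maximal\<close> transported by the congruence
  that diagonalises \<open>X 1\<close> and \<open>X 2\<close>.\<close>

lemma geo_mean_chain_maximal:
  fixes X :: "nat \<Rightarrow> real ^ 'n ^ 'n"
  assumes X1: "X 1 \<in> pd_mats" and X2: "X 2 \<in> psd_mats" and l: "4 \<le> l"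
    and sym: "\<And>i. i \<in> {1..l} \<Longrightarrow> X i \<in> sym_mats"
    and block: "\<And>i. i \<in> {4..l} \<Longrightarrow> block_mat (X (L i)) (X i) (X i) (X (R i)) \<succeq> 0"
    and \<nu>: "averaging l L R \<nu>" "\<nu> 1 = 0" "\<nu> 2 = 1" "\<nu> 3 = r" "\<nu> l = r"
    and r: "0 < r"
    and loop: "loop_weight L R l < 1" "X l = X 3"
  shows "geo_mean r (X 1) (X 2) \<succeq> X 3"
proof -
  obtain W W' :: "real ^ 'n ^ 'n" and d where WW': "W ** W' = mat 1" "W' ** W = mat 1" and d: "\<And>i. 0 \<le> d $ i"
    and X1_eq: "X 1 = W ** transpose W" and X2_eq: "X 2 = W ** diag_mat d ** transpose W"
    and geo: "\<And>r. r \<noteq> 0 \<Longrightarrow> geo_mean r (X 1) (X 2) = W ** diag_mat (\<chi> i. d $ i powr r) ** transpose W"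
    using geo_mean_simultaneous_diagonalization[OF X1 X2] by metis
  have tW: "transpose W' ** transpose W = mat 1" "transpose W ** transpose W' = mat 1"
    using WW' by (simp_all flip: matrix_transpose_mul)
  have cancel: "W' ** (W ** Z ** transpose W) ** transpose W' = Z"
    and cancel': "W ** (W' ** Z ** transpose W') ** transpose W = Z" for Z
  proof -
    have "W' ** (W ** Z ** transpose W) ** transpose W' = (W' ** W) ** Z ** (transpose W ** transpose W')"
      by (simp only: matrix_mul_assoc)
    then show "W' ** (W ** Z ** transpose W) ** transpose W' = Z"
      by (simp add: WW' tW)
    have "W ** (W' ** Z ** transpose W') ** transpose W = (W ** W') ** Z ** (transpose W' ** transpose W)"
      by (simp only: matrix_mul_assoc)
    then show "W ** (W' ** Z ** transpose W') ** transpose W = Z"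
      by (simp add: WW' tW)
  qed
  define Y where "Y i = W' ** X i ** transpose W'" for i
  have Ysym: "Y i \<in> sym_mats" if "i \<in> {1..l}" for i
    unfolding Y_def by (intro congruence_sym_mats sym that)
  have "diag_mat (\<chi> i. d $ i powr \<nu> 3) \<succeq> Y 3"
  proof (rule averaging_chain_maximal[OF l Ysym _ \<nu>(1-3)])
    show "block_mat (Y (L i)) (Y i) (Y i) (Y (R i)) \<succeq> 0" if i: "i \<in> {4..l}" for i
    proof -
      have "L i \<in> {1..<i}" "R i \<in> {1..<i}"
        using \<nu>(1) i by (auto simp: averaging_def)
      then show ?thesis
        unfolding Y_def using i by (intro block_mat_congruence block sym) auto
    qed
    show "Y 1 = mat 1"
      using cancel[of "mat 1"] by (simp add: Y_def X1_eq del: One_nat_def)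
    show "Y 2 = diag_mat d"
      using cancel by (simp add: Y_def X2_eq)
    show "Y l = Y 3"
      by (simp add: Y_def loop)
  qed (use d \<nu> r loop in auto)
  then have "W ** diag_mat (\<chi> i. d $ i powr r) ** transpose W \<succeq> W ** Y 3 ** transpose W"
    using Ysym l \<nu>(4) by (intro loewner_ge_congruence) auto
  then show ?thesis
    using r by (simp add: Y_def cancel' geo del: One_nat_def)
qed

lemma geo_mean_sym_mats:
  assumes "X1 \<in> pd_mats" "X2 \<in> psd_mats" "r \<noteq> 0"
  shows "geo_mean r X1 X2 \<in> sym_mats"
  using geo_mean_simultaneous_diagonalization[OF assms(1,2)] assms(3)
  by (metis congruence_sym_mats diag_mat_sym_mats)

theorem theorem37:
  fixes p q l a b :: nat and k :: "nat \<Rightarrow> nat" and lam :: real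
  assumes "0 < q" and "q < p" and "gcd p q = 1"
    and "lam = real q / real p"
    and "l = nat \<lceil>log 2 (real p)\<rceil> + 3"
    and "drawn_from_successive p q l a b k"
    and "scalar_soc_rep lam l a b k"
  shows "{(X1 :: real ^ 'n ^ 'n, X2, T).
            X1 \<in> pd_mats \<and> X2 \<in> psd_mats \<and> T \<in> sym_mats \<and> geo_mean lam X1 X2 \<succeq> T} =
         {(X1, X2, T).
            X1 \<in> pd_mats \<and> X2 \<in> psd_mats \<and> T \<in> sym_mats \<and>
            (\<exists>X :: nat \<Rightarrow> real ^ 'n ^ 'n. X 1 = X1 \<and> X 2 = X2 \<and>
               (\<forall>i\<in>{3..l}. X i \<in> sym_mats) \<and>
               X 3 = X l \<and> X l \<succeq> T \<and>
               block_mat (X a) (X 4) (X 4) (X b) \<succeq> 0 \<and>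
               (\<forall>i\<in>{5..l}. block_mat (X (i - 1)) (X i) (X i) (X (k i)) \<succeq> 0))}"
proof -
  let ?L = "(\<lambda>i. i - 1)(4 := a)" and ?R = "k(4 := b)"
  have "0 < log 2 (real p)"
    using assms by simp
  then have l: "4 \<le> l"
    using assms(5) by linarith
  have lam: "0 < lam"
    using assms by simp
  obtain \<nu> where \<nu>: "averaging l ?L ?R \<nu>" "\<nu> 1 = 0" "\<nu> 2 = 1" "\<nu> 3 = lam" "\<nu> l = lam" "\<And>i. 0 \<le> \<nu> i"
    using drawn_from_successive_averaging[OF assms(1,2,5,6)] assms(4) by metis
  have blocks: "(\<forall>i\<in>{4..l}. block_mat (X (?L i)) (X i) (X i) (X (?R i)) \<succeq> 0) \<longleftrightarrow>
      block_mat (X a) (X 4) (X 4) (X b) \<succeq> 0 \<and>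
      (\<forall>i\<in>{5..l}. block_mat (X (i - 1)) (X i) (X i) (X (k i)) \<succeq> 0)" for X :: "nat \<Rightarrow> real ^ 'n ^ 'n"
    unfolding ball_from_4[OF l] by auto
  have "geo_mean lam X1 X2 \<succeq> T \<longleftrightarrow>
      (\<exists>X :: nat \<Rightarrow> real ^ 'n ^ 'n. X 1 = X1 \<and> X 2 = X2 \<and> (\<forall>i\<in>{3..l}. X i \<in> sym_mats) \<and>
         X 3 = X l \<and> X l \<succeq> T \<and> (\<forall>i\<in>{4..l}. block_mat (X (?L i)) (X i) (X i) (X (?R i)) \<succeq> 0))"
    (is "_ \<longleftrightarrow> ?chain")
    if X1: "X1 \<in> pd_mats" and X2: "X2 \<in> psd_mats" and T: "T \<in> sym_mats" for X1 X2 T :: "real ^ 'n ^ 'n"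
  proof
    assume "geo_mean lam X1 X2 \<succeq> T"
    obtain X :: "nat \<Rightarrow> real ^ 'n ^ 'n" where "X 1 = X1" "X 2 = X2" "\<And>i. X i \<in> sym_mats"
      "\<And>i. \<nu> i = lam \<Longrightarrow> X i = geo_mean lam X1 X2"
      "\<And>i. i \<in> {4..l} \<Longrightarrow> block_mat (X (?L i)) (X i) (X i) (X (?R i)) \<succeq> 0"
      using geo_mean_chain_feasible[OF X1 X2 \<nu>(1-4,6) lam] by metis
    then show ?chain
      using \<open>geo_mean lam X1 X2 \<succeq> T\<close> \<nu>(4,5) by (intro exI[of _ X]) simp
  next
    assume ?chain
    then obtain X where X: "X 1 = X1" "X 2 = X2" "\<forall>i\<in>{3..l}. X i \<in> sym_mats" "X 3 = X l" "X l \<succeq> T"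
      and chain: "\<forall>i\<in>{4..l}. block_mat (X (?L i)) (X i) (X i) (X (?R i)) \<succeq> 0"
      by blast
    have "X i \<in> sym_mats" if "i \<in> {1..l}" for i
    proof -
      have "i = 1 \<or> i = 2 \<or> i \<in> {3..l}"
        using that by auto
      then show ?thesis
        using X X1 X2 by (auto simp: pd_mats_def psd_mats_def)
    qed
    then have "geo_mean lam (X 1) (X 2) \<succeq> X 3"
      using geo_mean_chain_maximal[of X l ?L ?R \<nu> lam] X X1 X2 l chain \<nu> lam
        scalar_soc_rep_loop_weight[OF assms(7) l \<nu>(1)] by metis
    then have ge: "geo_mean lam X1 X2 \<succeq> X l"
      by (simp only: X(1,2,4))
    have "geo_mean lam X1 X2 \<in> sym_mats" "X l \<in> sym_mats"
      using geo_mean_sym_mats[OF X1 X2, of lam] lam X(3) l by simp_all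
    then show "geo_mean lam X1 X2 \<succeq> T"
      using loewner_ge_trans[OF ge X(5)] T by blast
  qed
  note iff = this [unfolded blocks]
  show ?thesis
    by (intro Collect_cong prod.case_cong conj_cong refl) (rule iff; assumption)
qed

end
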